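(* For every $d\ge1$: (1) $\kappa_{d+1}\le\kappa_d$; (2) $\sqrt2<\sqrt2\,\bigl(1+2^{-2d}\bigr)^{1/[2(2d^2+1)]}\le\kappa_d\le\bigl(2^{2d+1}-1\bigr)^{1/(4d)}$; (3) $0\le\kappa_d-\sqrt2<\dfrac{\sqrt2\,(e-1)\log 2}{4d}$, where $e$ is the base of the natural logarithm. In particular, $\kappa_d\to\sqrt2$ as $d\to\infty$.
   Context: For integers $d,n\ge1$, $T_d(n)$ is the Cayley graph of $(\mathbb{Z}/n\mathbb{Z})^d$ with respect to $\{\pm e_1,\dots,\pm e_d\}\setminus\{0\}$ ($e_i$ the standard basis vectors); it is a simple graph, and $T_d(1)$ is a single vertex with no edges. $a_d(n)$ is the number of independent sets of $T_d(n)$ (including the empty set). The limit $\kappa_d=\lim_{n\to\infty}a_d(n)^{1/n^d}$ exists and is a positive real number. *)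

theory Defs
  imports Complex_Main "HOL-Library.Ramsey" "HOL-Algebra.Product_Groups"
begin

definition cayley_edges :: "('a, 'b) monoid_scheme \<Rightarrow> 'a set \<Rightarrow> 'a set set"
  where "cayley_edges G S = {{x, x \<otimes>\<^bsub>G\<^esub> s} |x s. x \<in> carrier G \<and> s \<in> S}"

definition torus_group :: "nat \<Rightarrow> nat \<Rightarrow> (nat \<Rightarrow> int) monoid"
  where "torus_group d n = product_group {..<d} (\<lambda>_. integer_mod_group n)"

text \<open>
  The coordinates are numbered \<open>0, \<dots>, d - 1\<close>, and residues modulo \<open>n\<close> are represented by
  \<open>0, \<dots>, n - 1\<close>. The reduction \<open>1 mod n\<close> only matters for \<open>n = 1\<close>, where the unit vector is \<open>0\<close>.
\<close>

definition unit_vec :: "nat \<Rightarrow> nat \<Rightarrow> nat \<Rightarrow> (nat \<Rightarrow> int)"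
  where "unit_vec d n i = (\<lambda>j\<in>{..<d}. if j = i then 1 mod int n else 0)"

definition torus_gens :: "nat \<Rightarrow> nat \<Rightarrow> (nat \<Rightarrow> int) set"
  where "torus_gens d n =
    (\<Union>i<d. {unit_vec d n i, inv\<^bsub>torus_group d n\<^esub> (unit_vec d n i)}) - {\<one>\<^bsub>torus_group d n\<^esub>}"

definition torus_edges :: "nat \<Rightarrow> nat \<Rightarrow> (nat \<Rightarrow> int) set set"
  where "torus_edges d n = cayley_edges (torus_group d n) (torus_gens d n)"

definition num_indep :: "nat \<Rightarrow> nat \<Rightarrow> nat"
  where "num_indep d n = card {I. I \<subseteq> carrier (torus_group d n) \<and> indep I (torus_edges d n)}"

text \<open>
  \<open>lim\<close> is unspecified for a divergent sequence, so statements about \<open>kappa d\<close> rest on the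
  convergence of this sequence for \<open>d \<ge> 1\<close>.
\<close>

definition kappa :: "nat \<Rightarrow> real"
  where "kappa d = lim (\<lambda>n. real (num_indep d n) powr (1 / real (n ^ d)))"

end

theory Submission
  imports Defs "HOL-Analysis.Convex"
begin

text \<open>
  Convergence is a Fekete argument: a large torus is tiled by boxes of side \<open>k\<close>, and such a box
  embeds as an induced subgraph in the torus of side \<open>k + 1\<close>. Monotonicity in \<open>d\<close> holds because
  the torus of dimension \<open>d + 1\<close> contains \<open>n\<close> disjoint copies of the one of dimension \<open>d\<close>.

  The bounds only have to be proved for even \<open>n\<close>, where the torus is bipartite and \<open>2 d\<close>-regular with
  classes \<open>A\<close>, \<open>B\<close>; the number of independent sets is then the sum over \<open>S \<subseteq> A\<close> of \<open>2\<close> to the number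
  of vertices of \<open>B\<close> without neighbour in \<open>S\<close>. This summand is a product over \<open>b \<in> B\<close> of functions
  of \<open>S \<inter> N b\<close>, so Finner's inequality gives Kahn's upper bound. For the lower bound, \<open>S\<close> has at
  most \<open>2 d |S|\<close> neighbours, whence \<open>\<kappa>\<^sub>d \<ge> \<surd>2 (1 + 2\<^bsup>-2d\<^esup>)\<^bsup>1/2\<^esup>\<close>, which is stronger than claimed.
\<close>

section \<open>Finner's inequality\<close>

text \<open>Hoelder's inequality for \<open>D\<close> functions on a two-point space, all with
  exponent \<open>D\<close>; \<open>u k\<close> and \<open>v k\<close> are the two values of the
  \<open>k\<close>-th function. After division by the right-hand side, AM-GM bounds each of the two
  products by a mean of \<open>D\<close>-th powers, and for each \<open>k\<close> the two normalised
  powers sum to 1.\<close>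

lemma prod_add_prod_le_prod_root:
  fixes u v :: "'a \<Rightarrow> real"
  assumes K: "finite K" "card K = D" "D \<ge> 1"
    and u: "\<And>k. k \<in> K \<Longrightarrow> 0 \<le> u k" and v: "\<And>k. k \<in> K \<Longrightarrow> 0 \<le> v k"
  shows "prod u K + prod v K \<le> (\<Prod>k\<in>K. root D (u k ^ D + v k ^ D))"
proof (cases "\<exists>k\<in>K. u k = 0 \<and> v k = 0")
  case True
  then have "prod u K = 0" "prod v K = 0"
    using K by (auto intro: prod_zero)
  then show ?thesis
    using u v \<open>D \<ge> 1\<close> by (auto intro!: prod_nonneg real_root_ge_zero)
next
  case False
  define w where "w k = root D (u k ^ D + v k ^ D)" for k
  have sum_pos: "u k ^ D + v k ^ D > 0" if "k \<in> K" for k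
    using False u[OF that] v[OF that] that
    by (metis add_nonneg_pos add_pos_nonneg less_eq_real_def zero_le_power zero_less_power)
  have w: "w k > 0" "w k ^ D = u k ^ D + v k ^ D" if "k \<in> K" for k
    using sum_pos[OF that] K by (auto simp: w_def)
  \<comment> \<open>AM-GM for the \<open>D\<close> numbers \<open>(f k / w k) ^ D\<close>, whose
    geometric mean is the normalised product. It is used for \<open>f = u\<close> and
    \<open>f = v\<close>.\<close>
  have mean: "prod f K / prod w K \<le> (\<Sum>k\<in>K. f k ^ D / w k ^ D / D)"
    if f: "\<And>k. k \<in> K \<Longrightarrow> 0 \<le> f k" for f
  proof -
    have "K \<noteq> {}" using K by auto
    have root: "(x ^ D) powr (1 / D) = x" if "x \<ge> 0" for x :: real
      using K that by (cases "x = 0") (simp_all add: powr_powr flip: powr_realpow)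
    have "(\<Prod>k\<in>K. f k / w k) \<ge> 0"
      using f w by (intro prod_nonneg) (auto simp: less_imp_le)
    then have "(\<Prod>k\<in>K. (f k / w k) ^ D) powr (1 / D) = (\<Prod>k\<in>K. f k / w k)"
      using root by (simp flip: prod_power_distrib)
    then show ?thesis
      using arith_geom_mean[OF K(1) \<open>K \<noteq> {}\<close>, of "\<lambda>k. (f k / w k) ^ D"] K f w(1)
      by (simp add: prod_dividef power_divide less_imp_le)
  qed
  have "prod u K / prod w K + prod v K / prod w K
      \<le> (\<Sum>k\<in>K. (u k ^ D + v k ^ D) / w k ^ D / D)"
    using mean[of u] mean[of v] u v by (simp add: add_divide_distrib sum.distrib)
  also have "\<dots> = (\<Sum>k\<in>K. 1 / D)"
    using w(2) sum_pos by (intro sum.cong refl) (simp add: order_less_imp_not_eq2)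
  also have "\<dots> = 1" using K by simp
  finally show ?thesis
    using prod_pos[of K w] w by (simp add: w_def field_simps)
qed

lemma sum_Pow_insert:
  assumes "finite A" "a \<notin> A"
  shows "(\<Sum>S\<in>Pow (insert a A). f S) = (\<Sum>S\<in>Pow A. f S + f (insert a S))"
proof -
  have "(\<Sum>S\<in>Pow (insert a A). f S) = (\<Sum>S\<in>Pow A. f S) + (\<Sum>S\<in>insert a ` Pow A. f S)"
    unfolding Pow_insert using assms by (intro sum.union_disjoint) auto
  also have "(\<Sum>S\<in>insert a ` Pow A. f S) = (\<Sum>S\<in>Pow A. f (insert a S))"
    using assms by (intro sum.reindex_cong[of "insert a"]) (auto simp: inj_on_def)
  finally show ?thesis by (simp add: sum.distrib)
qed

text \<open>Finner's inequality on the discrete cube, the functional form of Shearer's lemma.\<close>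
lemma sum_Pow_prod_le_prod_root:
  fixes F :: "'b \<Rightarrow> 'a set \<Rightarrow> real"
  assumes "finite A" "finite B" "D \<ge> 1"
    and "\<And>a. a \<in> A \<Longrightarrow> card {b \<in> B. a \<in> N b} = D"
    and "\<And>b S. 0 \<le> F b S"
  shows "(\<Sum>S\<in>Pow A. \<Prod>b\<in>B. F b (S \<inter> N b))
    \<le> (\<Prod>b\<in>B. root D (\<Sum>S\<in>Pow (A \<inter> N b). F b S ^ D))"
  using assms(1,4,5)
proof (induction A arbitrary: F rule: finite_induct)
  case empty
  then show ?case using \<open>D \<ge> 1\<close> by (simp add: real_root_power_cancel)
next
  case (insert a A)
  define K where "K = {b \<in> B. a \<in> N b}"
  \<comment> \<open>\<open>G\<close> sums out the coordinate \<open>a\<close>: each of the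
    \<open>D\<close> factors that depend on \<open>a\<close> is replaced by its
    \<ell>^\<open>D\<close>-norm in that coordinate, and the other factors stay as they are. The
    induction hypothesis is then applied to \<open>G\<close>.\<close>
  define G where "G b S = (if b \<in> K then root D (F b S ^ D + F b (insert a S) ^ D) else F b S)" for b S
  have K: "finite K" "card K = D" "K \<subseteq> B"
    using insert.prems(1)[of a] assms(2) by (auto simp: K_def)
  have G_nonneg: "0 \<le> G b S" for b S
    using insert.prems(2) assms(3) by (simp add: G_def real_root_ge_zero)
  have "(\<Sum>S\<in>Pow (insert a A). \<Prod>b\<in>B. F b (S \<inter> N b))
      = (\<Sum>S\<in>Pow A. (\<Prod>b\<in>B. F b (S \<inter> N b)) + (\<Prod>b\<in>B. F b (insert a S \<inter> N b)))"
    using insert.hyps by (rule sum_Pow_insert)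
  also have "\<dots> \<le> (\<Sum>S\<in>Pow A. \<Prod>b\<in>B. G b (S \<inter> N b))"
  proof (rule sum_mono)
    fix S
    \<comment> \<open>The factors outside \<open>K\<close> are the same for \<open>S\<close> and
      \<open>insert a S\<close>, so they can be pulled out; the two-term inequality is needed on
      \<open>K\<close> only.\<close>
    have split: "prod f B = prod f (B - K) * prod f K" for f :: "'b \<Rightarrow> real"
      using K assms(2) by (metis prod.subset_diff)
    have 1: "(\<Prod>b\<in>B-K. F b (insert a S \<inter> N b)) = (\<Prod>b\<in>B-K. F b (S \<inter> N b))"
      by (intro prod.cong) (auto simp: K_def)
    have 2: "(\<Prod>b\<in>B-K. G b (S \<inter> N b)) = (\<Prod>b\<in>B-K. F b (S \<inter> N b))"
      by (intro prod.cong) (auto simp: G_def)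
    have 3: "(\<Prod>b\<in>K. F b (insert a S \<inter> N b)) = (\<Prod>b\<in>K. F b (insert a (S \<inter> N b)))"
      by (intro prod.cong) (auto simp: K_def)
    have 4: "(\<Prod>b\<in>K. G b (S \<inter> N b))
        = (\<Prod>b\<in>K. root D (F b (S \<inter> N b) ^ D + F b (insert a (S \<inter> N b)) ^ D))"
      by (intro prod.cong) (auto simp: G_def)
    show "(\<Prod>b\<in>B. F b (S \<inter> N b)) + (\<Prod>b\<in>B. F b (insert a S \<inter> N b)) \<le> (\<Prod>b\<in>B. G b (S \<inter> N b))"
      unfolding split 1 2 3 4
      using prod_add_prod_le_prod_root[OF K(1,2) assms(3), of "\<lambda>b. F b (S \<inter> N b)" "\<lambda>b. F b (insert a (S \<inter> N b))"]
        insert.prems(2)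
      by (simp add: mult_left_mono prod_nonneg flip: distrib_left)
  qed
  also have "\<dots> \<le> (\<Prod>b\<in>B. root D (\<Sum>S\<in>Pow (A \<inter> N b). G b S ^ D))"
    using insert.prems(1) G_nonneg by (intro insert.IH) auto
  also have "\<dots> = (\<Prod>b\<in>B. root D (\<Sum>S\<in>Pow (insert a A \<inter> N b). F b S ^ D))"
  proof (intro prod.cong refl arg_cong[where f = "root D"])
    fix b assume "b \<in> B"
    show "(\<Sum>S\<in>Pow (A \<inter> N b). G b S ^ D) = (\<Sum>S\<in>Pow (insert a A \<inter> N b). F b S ^ D)"
    proof (cases "a \<in> N b")
      case True
      then have "b \<in> K" using \<open>b \<in> B\<close> by (simp add: K_def)
      \<comment> \<open>Taking the \<open>D\<close>-th power undoes the root in \<open>G\<close>,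
        which leaves the two terms for subsets without and with \<open>a\<close>.\<close>
      have "(\<Sum>S\<in>Pow (insert a A \<inter> N b). F b S ^ D)
          = (\<Sum>S\<in>Pow (A \<inter> N b). F b S ^ D + F b (insert a S) ^ D)"
        using sum_Pow_insert[of "A \<inter> N b" a] insert.hyps True by simp
      then show ?thesis
        using \<open>b \<in> K\<close> assms(3) insert.prems(2) by (simp add: G_def)
    qed (simp add: G_def K_def)
  qed
  finally show ?case .
qed

section \<open>Counting independent sets\<close>

text \<open>The edges in \<open>E\<close> may reach outside \<open>V\<close>, so this counts the
  independent sets of the subgraph induced on \<open>V\<close>. Pieces of a torus can thus be
  counted with the edge set of the whole torus.\<close>

definition indep_count :: "'a set \<Rightarrow> 'a set set \<Rightarrow> nat"
  where "indep_count V E = card {I. I \<subseteq> V \<and> indep I E}"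

lemma finite_indep_sets: "finite V \<Longrightarrow> finite {I. I \<subseteq> V \<and> indep I E}"
  by (rule finite_subset[of _ "Pow V"]) auto

lemma indep_count_empty: "indep_count {} E = 1"
  by (simp add: indep_count_def cong: conj_cong)

lemma indep_count_pos: "finite V \<Longrightarrow> indep_count V E > 0"
  unfolding indep_count_def card_gt_0_iff using finite_indep_sets by fastforce

lemma indep_count_le: "finite V \<Longrightarrow> indep_count V E \<le> 2 ^ card V"
  unfolding indep_count_def by (subst card_Pow[symmetric]) (auto intro: card_mono)

text \<open>An independent set is determined by its traces on \<open>V\<close> and \<open>W\<close>,
  and both traces are independent.\<close>

lemma indep_count_Un:
  assumes "finite V" "finite W"
  shows "indep_count (V \<union> W) E \<le> indep_count V E * indep_count W E"
proof -
  let ?f = "\<lambda>I. (I \<inter> V, I \<inter> W)"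
  have "indep_count (V \<union> W) E
      \<le> card ({I. I \<subseteq> V \<and> indep I E} \<times> {I. I \<subseteq> W \<and> indep I E})"
    unfolding indep_count_def
  proof (rule card_inj_on_le[of ?f])
    show "inj_on ?f {I. I \<subseteq> V \<union> W \<and> indep I E}"
      by (intro inj_onI) blast
  qed (use assms in \<open>auto intro: smaller_indep finite_indep_sets\<close>)
  then show ?thesis by (simp add: indep_count_def card_cartesian_product)
qed

lemma indep_count_UN:
  assumes "finite Q" "\<And>q. q \<in> Q \<Longrightarrow> finite (V q)"
  shows "indep_count (\<Union>q\<in>Q. V q) E \<le> (\<Prod>q\<in>Q. indep_count (V q) E)"
  using assms
proof (induction Q rule: finite_induct)
  case (insert q Q)
  then show ?case
    using indep_count_Un[of "V q" "\<Union>q\<in>Q. V q" E] by (auto intro: order.trans mult_le_mono)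
qed (simp add: indep_count_empty)

text \<open>Since edges between image points pull back along \<open>f\<close>, images of independent
  sets are independent, and distinct sets have distinct images by injectivity.\<close>

lemma indep_count_embed:
  assumes "finite W" "f ` V \<subseteq> W" "inj_on f V"
    and "\<And>u v. u \<in> V \<Longrightarrow> v \<in> V \<Longrightarrow> {f u, f v} \<in> E' \<Longrightarrow> {u, v} \<in> E"
  shows "indep_count V E \<le> indep_count W E'"
  unfolding indep_count_def
proof (rule card_inj_on_le[of "image f"])
  show "inj_on (image f) {I. I \<subseteq> V \<and> indep I E}"
    using assms(3) by (auto intro!: inj_onI simp: inj_on_image_eq_iff)
  show "image f ` {I. I \<subseteq> V \<and> indep I E} \<subseteq> {I. I \<subseteq> W \<and> indep I E'}"
  proof (rule image_subsetI, clarify)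
    fix I assume I: "I \<subseteq> V" "indep I E"
    have "{f u, f v} \<notin> E'" if "u \<in> I" "v \<in> I" "f u \<noteq> f v" for u v
      using I that assms(4)[of u v] unfolding indep_def by (metis subsetD)
    then show "f ` I \<subseteq> W \<and> indep (f ` I) E'"
      using I(1) assms(2) unfolding indep_def by blast
  qed
qed (use assms in \<open>simp add: finite_indep_sets\<close>)

text \<open>The binomial theorem with its terms indexed by subsets.\<close>

lemma sum_Pow_power_card:
  fixes c :: real
  assumes "finite P"
  shows "(\<Sum>S\<in>Pow P. c ^ card S) = (1 + c) ^ card P"
  using assms
proof (induction P rule: finite_induct)
  case (insert a P)
  have "(\<Sum>S\<in>Pow (insert a P). c ^ card S) = (\<Sum>S\<in>Pow P. c ^ card S + c ^ card (insert a S))"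
    using insert.hyps by (rule sum_Pow_insert)
  also have "\<dots> = (\<Sum>S\<in>Pow P. (1 + c) * c ^ card S)"
  proof (intro sum.cong refl)
    fix S assume "S \<in> Pow P"
    then have "finite S" "a \<notin> S" using insert.hyps finite_subset by auto
    then show "c ^ card S + c ^ card (insert a S) = (1 + c) * c ^ card S"
      by (simp add: algebra_simps)
  qed
  finally show ?case using insert by (simp flip: sum_distrib_left)
qed simp

section \<open>Independent sets of bipartite graphs\<close>

locale bipartite_graph =
  fixes A B :: "'a set" and E :: "'a set set" and N :: "'a \<Rightarrow> 'a set"
  assumes finite_A: "finite A" and finite_B: "finite B" and disjoint: "A \<inter> B = {}"
    and A_stable: "indep A E" and B_stable: "indep B E"
    and edge_iff: "\<And>a b. a \<in> A \<Longrightarrow> b \<in> B \<Longrightarrow> {a, b} \<in> E \<longleftrightarrow> a \<in> N b"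
begin

lemma indep_Un_iff:
  assumes "S \<subseteq> A" "R \<subseteq> B"
  shows "indep (S \<union> R) E \<longleftrightarrow> R \<subseteq> {b \<in> B. S \<inter> N b = {}}"
proof -
  have "indep S E" "indep R E"
    using assms A_stable B_stable smaller_indep by blast+
  have "indep (S \<union> R) E \<longleftrightarrow> (\<forall>a\<in>S. \<forall>b\<in>R. {a, b} \<notin> E)"
    (is "?l \<longleftrightarrow> ?r")
  proof
    assume ?l
    show ?r
    proof (intro ballI)
      fix a b assume ab: "a \<in> S" "b \<in> R"
      then have "a \<noteq> b" using assms disjoint by blast
      with ab \<open>?l\<close> show "{a, b} \<notin> E" unfolding indep_def by blast
    qed
  next
    assume ?r
    then have "{b, a} \<notin> E" if "a \<in> S" "b \<in> R" for a b
      using that by (simp add: insert_commute)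
    with \<open>?r\<close> \<open>indep S E\<close> \<open>indep R E\<close> show ?l unfolding indep_def by blast
  qed
  also have "\<dots> \<longleftrightarrow> R \<subseteq> {b \<in> B. S \<inter> N b = {}}"
    using assms edge_iff by blast
  finally show ?thesis .
qed

text \<open>Once the trace \<open>S\<close> on \<open>A\<close> is fixed, the trace on
  \<open>B\<close> may be any set of vertices without neighbour in \<open>S\<close>.\<close>

lemma indep_count_eq:
  "indep_count (A \<union> B) E = (\<Sum>S\<in>Pow A. 2 ^ card {b \<in> B. S \<inter> N b = {}})"
proof -
  have "bij_betw (\<lambda>(S, R). S \<union> R) (SIGMA S:Pow A. Pow {b \<in> B. S \<inter> N b = {}})
      {I. I \<subseteq> A \<union> B \<and> indep I E}"
  proof (rule bij_betw_byWitness[where f' = "\<lambda>I. (I \<inter> A, I \<inter> B)"])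
    show "(\<lambda>(S, R). S \<union> R) ` (SIGMA S:Pow A. Pow {b \<in> B. S \<inter> N b = {}})
        \<subseteq> {I. I \<subseteq> A \<union> B \<and> indep I E}"
    proof (rule image_subsetI)
      fix p assume "p \<in> (SIGMA S:Pow A. Pow {b \<in> B. S \<inter> N b = {}})"
      then obtain S R where p: "p = (S, R)" "S \<subseteq> A" "R \<subseteq> {b \<in> B. S \<inter> N b = {}}"
        by blast
      then have "indep (S \<union> R) E"
        using indep_Un_iff[of S R] by blast
      with p show "(\<lambda>(S, R). S \<union> R) p \<in> {I. I \<subseteq> A \<union> B \<and> indep I E}"
        by auto
    qed
    show "(\<lambda>I. (I \<inter> A, I \<inter> B)) ` {I. I \<subseteq> A \<union> B \<and> indep I E}
        \<subseteq> (SIGMA S:Pow A. Pow {b \<in> B. S \<inter> N b = {}})"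
    proof (rule image_subsetI)
      fix I assume "I \<in> {I. I \<subseteq> A \<union> B \<and> indep I E}"
      then have I: "I \<subseteq> A \<union> B" "indep I E" by auto
      then have "I \<inter> A \<union> I \<inter> B = I" by blast
      then show "(I \<inter> A, I \<inter> B) \<in> (SIGMA S:Pow A. Pow {b \<in> B. S \<inter> N b = {}})"
        using indep_Un_iff[of "I \<inter> A" "I \<inter> B"] I by auto
    qed
  qed (use disjoint in auto)
  from bij_betw_same_card[OF this] show ?thesis
    using finite_A finite_B by (simp add: indep_count_def card_Pow)
qed

text \<open>Kahn's bound for \<open>D\<close>-regular bipartite graphs. The power of 2 in
  \<open>indep_count_eq\<close> is a product over \<open>b\<close> of a factor that is 2 if
  \<open>S\<close> misses \<open>N b\<close> and 1 otherwise; every \<open>a\<close> lies in exactly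
  \<open>D\<close> of the sets \<open>N b\<close>, so Finner's inequality applies with exponent
  \<open>D\<close>.\<close>

lemma indep_count_upper:
  assumes "D \<ge> 1" "\<And>a. a \<in> A \<Longrightarrow> card {b \<in> B. a \<in> N b} = D"
    and N: "\<And>b. b \<in> B \<Longrightarrow> N b \<subseteq> A" "\<And>b. b \<in> B \<Longrightarrow> card (N b) = D"
  shows "real (indep_count (A \<union> B) E) \<le> root D (2 ^ (D + 1) - 1) ^ card B"
proof -
  define F :: "'a set \<Rightarrow> real" where "F S = (if S = {} then 2 else 1)" for S
  have "real (indep_count (A \<union> B) E) = (\<Sum>S\<in>Pow A. \<Prod>b\<in>B. F (S \<inter> N b))"
    unfolding indep_count_eq of_nat_sum
  proof (intro sum.cong refl)
    fix S
    have "(\<Prod>b\<in>B. F (S \<inter> N b)) = (\<Prod>b\<in>{b \<in> B. S \<inter> N b = {}}. 2)"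
      using finite_B by (subst prod.inter_filter) (auto simp: F_def intro!: prod.cong)
    then show "real (2 ^ card {b \<in> B. S \<inter> N b = {}}) = (\<Prod>b\<in>B. F (S \<inter> N b))"
      by simp
  qed
  also have "\<dots> \<le> (\<Prod>b\<in>B. root D (\<Sum>S\<in>Pow (A \<inter> N b). F S ^ D))"
    using finite_A finite_B assms(1,2) by (rule sum_Pow_prod_le_prod_root) (auto simp: F_def)
  also have "\<dots> = (\<Prod>b\<in>B. root D (2 ^ (D + 1) - 1))"
  proof (intro prod.cong refl arg_cong[where f = "root D"])
    fix b assume b: "b \<in> B"
    have fin: "finite (N b)" using N(1)[OF b] finite_A finite_subset by blast
    have "(\<Sum>S\<in>Pow (A \<inter> N b). F S ^ D) = (\<Sum>S\<in>Pow (N b). F S ^ D)"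
      using N(1)[OF b] by (simp add: Int_absorb1)
    \<comment> \<open>The empty set contributes \<open>2 ^ D\<close> and each of the
      \<open>2 ^ D - 1\<close> other subsets of \<open>N b\<close> contributes 1.\<close>
    also have "\<dots> = F {} ^ D + (\<Sum>S\<in>Pow (N b) - {{}}. F S ^ D)"
      using fin by (intro sum.remove) auto
    also have "(\<Sum>S\<in>Pow (N b) - {{}}. F S ^ D) = (\<Sum>S\<in>Pow (N b) - {{}}. 1)"
      by (intro sum.cong) (auto simp: F_def)
    also have "\<dots> = real (2 ^ D - 1)"
      using N(2)[OF b] fin by (simp add: card_Diff_subset card_Pow)
    finally show "(\<Sum>S\<in>Pow (A \<inter> N b). F S ^ D) = 2 ^ (D + 1) - 1"
      by (simp add: F_def of_nat_diff)
  qed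
  finally show ?thesis by simp
qed

text \<open>A set \<open>S\<close> blocks at most \<open>D * card S\<close> vertices of
  \<open>B\<close>. Each summand of \<open>indep_count_eq\<close> is therefore at least
  \<open>2 ^ card B\<close> times the \<open>card S\<close>-th power of \<open>(1 / 2) ^ D\<close>,
  and these bounds are summed by the binomial theorem.\<close>

lemma indep_count_lower:
  assumes "\<And>a. a \<in> A \<Longrightarrow> card {b \<in> B. a \<in> N b} = D"
  shows "2 ^ card B * (1 + (1 / 2) ^ D) ^ card A \<le> real (indep_count (A \<union> B) E)"
proof -
  have "2 ^ card B * (1 + (1 / 2) ^ D) ^ card A = (\<Sum>S\<in>Pow A. 2 ^ card B * ((1 / 2 :: real) ^ D) ^ card S)"
    using finite_A by (simp add: sum_Pow_power_card flip: sum_distrib_left)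
  also have "\<dots> \<le> (\<Sum>S\<in>Pow A. 2 ^ card {b \<in> B. S \<inter> N b = {}})"
  proof (rule sum_mono)
    fix S assume S: "S \<in> Pow A"
    then have "finite S" using finite_A finite_subset by auto
    then have "card B \<le> card ({b \<in> B. S \<inter> N b = {}} \<union> (\<Union>a\<in>S. {b \<in> B. a \<in> N b}))"
      using finite_B by (intro card_mono) auto
    also have "\<dots> \<le> card {b \<in> B. S \<inter> N b = {}} + card (\<Union>a\<in>S. {b \<in> B. a \<in> N b})"
      by (rule card_Un_le)
    also have "card (\<Union>a\<in>S. {b \<in> B. a \<in> N b}) \<le> (\<Sum>a\<in>S. card {b \<in> B. a \<in> N b})"
      using \<open>finite S\<close> by (rule card_UN_le)
    also have "\<dots> = card S * D"
      using S assms by (simp add: subset_iff)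
    finally have "card B \<le> card {b \<in> B. S \<inter> N b = {}} + card S * D"
      by simp
    then have "(2::real) ^ card B \<le> 2 ^ (card {b \<in> B. S \<inter> N b = {}} + card S * D)"
      by (intro power_increasing) auto
    then show "2 ^ card B * ((1 / 2 :: real) ^ D) ^ card S \<le> 2 ^ card {b \<in> B. S \<inter> N b = {}}"
      by (simp add: power_add power_one_over field_simps flip: power_mult)
  qed
  finally show ?thesis by (simp add: indep_count_eq)
qed

end

section \<open>The torus graph\<close>

text \<open>The vertex set as an explicit set of extensional functions. It agrees with the carrier
  of \<open>torus_group d n\<close> for positive \<open>n\<close>;
  \<open>integer_mod_group 0\<close> is the group of all integers.\<close>

definition torus :: "nat \<Rightarrow> nat \<Rightarrow> (nat \<Rightarrow> int) set"
  where "torus d n = (\<Pi>\<^sub>E i\<in>{..<d}. {0..<int n})"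

definition shift :: "nat \<Rightarrow> (nat \<Rightarrow> int) \<Rightarrow> nat \<Rightarrow> int \<Rightarrow> (nat \<Rightarrow> int)"
  where "shift n x i s = x(i := (x i + s) mod int n)"

definition nbrs :: "nat \<Rightarrow> nat \<Rightarrow> (nat \<Rightarrow> int) \<Rightarrow> (nat \<Rightarrow> int) set"
  where "nbrs d n x = (\<lambda>(i, s). shift n x i s) ` ({..<d} \<times> {1, -1})"

lemma mem_nbrs_iff: "y \<in> nbrs d n x \<longleftrightarrow> (\<exists>i<d. \<exists>s\<in>{1, -1}. y = shift n x i s)"
  by (auto simp: nbrs_def)

lemma finite_torus: "finite (torus d n)"
  by (simp add: torus_def finite_PiE)

lemma card_torus: "card (torus d n) = n ^ d"
  by (simp add: torus_def card_PiE)

lemma torus_range: "x \<in> torus d n \<Longrightarrow> i < d \<Longrightarrow> 0 \<le> x i \<and> x i < int n"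
  by (fastforce simp: torus_def dest: PiE_mem)

lemma torus_eqI:
  "x \<in> torus d n \<Longrightarrow> y \<in> torus d m \<Longrightarrow> (\<And>i. i < d \<Longrightarrow> x i = y i) \<Longrightarrow> x = y"
  unfolding torus_def by (rule PiE_ext) auto

lemma carrier_torus_group: "n > 0 \<Longrightarrow> carrier (torus_group d n) = torus d n"
  by (simp add: torus_group_def torus_def carrier_integer_mod_group)

lemma shift_in_torus: "x \<in> torus d n \<Longrightarrow> i < d \<Longrightarrow> n > 0 \<Longrightarrow> shift n x i s \<in> torus d n"
  by (auto simp: torus_def shift_def PiE_iff extensional_def)

lemma shift_shift:
  assumes "x \<in> torus d n" "i < d" "n > 0"
  shows "shift n (shift n x i s) i (- s) = x"
  using torus_range[OF assms(1,2)] by (simp add: shift_def mod_simps)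

lemma nbrs_sym:
  assumes "x \<in> torus d n" "n > 0" "y \<in> nbrs d n x"
  shows "x \<in> nbrs d n y"
proof -
  obtain i s where "i < d" "s \<in> {1, -1}" "y = shift n x i s"
    using assms(3) mem_nbrs_iff by blast
  then have "x = shift n y i (- s)" "- s \<in> {1, -1}"
    using assms shift_shift by auto
  with \<open>i < d\<close> show ?thesis using mem_nbrs_iff by blast
qed

text \<open>For these \<open>n\<close> no unit vector or inverse of one is trivial, so removing the
  identity from the generators changes nothing, and multiplication by a generator is a shift. As
  \<open>nbrs\<close> is symmetric, an unordered edge can be read from either end.\<close>

lemma torus_edges_iff:
  assumes n: "n \<ge> 3" and x: "x \<in> torus d n" and y: "y \<in> torus d n"
  shows "{x, y} \<in> torus_edges d n \<longleftrightarrow> y \<in> nbrs d n x"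
proof -
  \<comment> \<open>\<open>e i 1\<close> is the \<open>i\<close>-th unit vector and
    \<open>e i (-1)\<close> its inverse.\<close>
  define e where "e i s = (\<lambda>j\<in>{..<d}. if j = i then s mod int n else 0)" for i s
  have m1: "(- 1) mod int n = int n - 1" "1 mod int n = 1"
    using n by (simp_all add: zmod_minus1)
  have one: "\<one>\<^bsub>torus_group d n\<^esub> = (\<lambda>j\<in>{..<d}. 0)"
    by (simp add: torus_group_def)
  have inv: "inv\<^bsub>torus_group d n\<^esub> (unit_vec d n i) = e i (-1)" if "i < d" for i
  proof -
    have "unit_vec d n i \<in> (\<Pi>\<^sub>E i\<in>{..<d}. carrier (integer_mod_group n))"
      using n m1 by (auto simp: unit_vec_def carrier_integer_mod_group)
    then have "inv\<^bsub>torus_group d n\<^esub> (unit_vec d n i)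
        = (\<lambda>j\<in>{..<d}. inv\<^bsub>integer_mod_group n\<^esub> (unit_vec d n i j))"
      unfolding torus_group_def by (intro inv_product_group) auto
    also have "\<dots> = e i (-1)"
      unfolding e_def
    proof (rule restrict_ext)
      fix j assume "j \<in> {..<d}"
      have "inv\<^bsub>integer_mod_group n\<^esub> (unit_vec d n i j) = (- unit_vec d n i j) mod int n"
        using n m1 \<open>j \<in> {..<d}\<close>
        by (intro inv_integer_mod_group) (auto simp: unit_vec_def carrier_integer_mod_group)
      then show "inv\<^bsub>integer_mod_group n\<^esub> (unit_vec d n i j) = (if j = i then - 1 mod int n else 0)"
        using \<open>j \<in> {..<d}\<close> m1 by (simp add: unit_vec_def)
    qed
    finally show ?thesis .
  qed
  have e_ne: "e i s \<noteq> \<one>\<^bsub>torus_group d n\<^esub>" if "i < d" "s \<in> {1, -1}" for i s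
    using that n m1 by (auto simp: one e_def fun_eq_iff restrict_def intro!: exI[of _ i])
  have "torus_gens d n = (\<Union>i<d. {e i 1, e i (-1)}) - {\<one>\<^bsub>torus_group d n\<^esub>}"
    using inv by (auto simp: torus_gens_def unit_vec_def e_def)
  then have gens: "torus_gens d n = {e i s |i s. i < d \<and> s \<in> {1, -1}}"
    using e_ne by blast
  have mult: "z \<otimes>\<^bsub>torus_group d n\<^esub> e i s = shift n z i s" if "z \<in> torus d n" "i < d" for z i s
  proof (rule ext)
    fix j
    show "(z \<otimes>\<^bsub>torus_group d n\<^esub> e i s) j = shift n z i s j"
      using that torus_range[OF that(1), of j]
      by (auto simp: torus_group_def e_def shift_def mod_simps torus_def PiE_iff extensional_def)
  qed
  have "torus_edges d n = {{z, shift n z i s} |z i s. z \<in> torus d n \<and> i < d \<and> s \<in> {1, -1}}"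
    unfolding torus_edges_def cayley_edges_def gens using n mult
    by (auto simp: carrier_torus_group) (metis mult)+
  also have "\<dots> = {{z, w} |z w. z \<in> torus d n \<and> w \<in> nbrs d n z}"
    unfolding mem_nbrs_iff by blast
  finally show ?thesis
    using nbrs_sym[of y d n x] x y n by (auto simp: doubleton_eq_iff)
qed

lemma num_indep_eq: "n > 0 \<Longrightarrow> num_indep d n = indep_count (torus d n) (torus_edges d n)"
  by (simp add: num_indep_def indep_count_def carrier_torus_group)

lemma num_indep_pos: "n > 0 \<Longrightarrow> num_indep d n > 0"
  by (simp add: num_indep_eq indep_count_pos finite_torus)

lemma num_indep_le: "n > 0 \<Longrightarrow> num_indep d n \<le> 2 ^ (n ^ d)"
  by (metis num_indep_eq indep_count_le finite_torus card_torus)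

lemma shift_neq:
  assumes "x \<in> torus d n" "i < d" "n \<ge> 3" "s \<in> {1, -1}"
  shows "shift n x i s i \<noteq> x i"
proof -
  have "\<not> int n dvd s" using assms by (auto dest: zdvd_imp_le)
  then have "(x i + s) mod int n \<noteq> x i mod int n"
    by (simp add: mod_eq_dvd_iff)
  then show ?thesis using torus_range[OF assms(1,2)] by (simp add: shift_def)
qed

text \<open>A shift changes exactly one coordinate, which recovers \<open>i\<close>; the sign is
  recovered because \<open>n \<ge> 3\<close> does not divide 2.\<close>

lemma card_nbrs:
  assumes "x \<in> torus d n" "n \<ge> 3"
  shows "card (nbrs d n x) = 2 * d"
proof -
  have "inj_on (\<lambda>(i, s). shift n x i s) ({..<d} \<times> {1, -1})"
  proof (rule inj_onI, clarify)
    fix i j s t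
    assume *: "i < d" "j < d" "s \<in> {1, -1}" "t \<in> {1, -1 :: int}" "shift n x i s = shift n x j t"
    then have "i = j"
      using shift_neq[OF assms(1) _ assms(2), of i s] by (metis fun_upd_other shift_def)
    then have "(x i + s) mod int n = (x i + t) mod int n"
      using *(5) by (auto simp: shift_def dest: fun_cong[of _ _ i])
    then have "int n dvd s - t"
      by (simp add: mod_eq_dvd_iff)
    then have "s = t"
      using *(3,4) assms(2) zdvd_imp_le[of "int n" 2] by auto
    with \<open>i = j\<close> show "i = j \<and> s = t" by simp
  qed
  then show ?thesis
    by (simp add: nbrs_def card_image card_cartesian_product)
qed

section \<open>The bipartition for even side length\<close>

definition even_part :: "nat \<Rightarrow> nat \<Rightarrow> (nat \<Rightarrow> int) set"
  where "even_part d n = {x \<in> torus d n. even (\<Sum>i<d. x i)}"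

definition odd_part :: "nat \<Rightarrow> nat \<Rightarrow> (nat \<Rightarrow> int) set"
  where "odd_part d n = {x \<in> torus d n. odd (\<Sum>i<d. x i)}"

text \<open>Reduction modulo an even number preserves parity, so a unit step flips the parity of the
  coordinate sum even where it wraps around.\<close>

lemma even_sum_shift:
  assumes "even n" "i < d" "s \<in> {1, -1}"
  shows "even (\<Sum>j<d. shift n x i s j) \<longleftrightarrow> odd (\<Sum>j<d. x j)"
proof -
  have "(\<Sum>j<d. shift n x i s j) = (x i + s) mod int n + (\<Sum>j\<in>{..<d}-{i}. x j)"
    using assms(2) by (subst sum.remove[of _ i]) (auto simp: shift_def intro!: sum.cong)
  moreover have "(\<Sum>j<d. x j) = x i + (\<Sum>j\<in>{..<d}-{i}. x j)"
    using assms(2) by (intro sum.remove) auto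
  moreover have "even ((x i + s) mod int n) \<longleftrightarrow> even (x i + s)"
    using assms(1) by (intro dvd_mod_iff) auto
  ultimately show ?thesis using assms(3) by auto
qed

lemma nbrs_parity:
  assumes "even n" "n > 0"
  shows "x \<in> even_part d n \<Longrightarrow> nbrs d n x \<subseteq> odd_part d n"
    and "x \<in> odd_part d n \<Longrightarrow> nbrs d n x \<subseteq> even_part d n"
  using assms by (auto simp: mem_nbrs_iff even_part_def odd_part_def shift_in_torus even_sum_shift)

lemma even_odd_part:
  "even_part d n \<union> odd_part d n = torus d n" "even_part d n \<inter> odd_part d n = {}"
  by (auto simp: even_part_def odd_part_def)

lemma finite_parts: "finite (even_part d n)" "finite (odd_part d n)"
  by (auto simp: even_part_def odd_part_def finite_torus)

text \<open>A unit shift of coordinate 0 exchanges the two classes.\<close>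

lemma card_parts:
  assumes "even n" "n > 0" "d > 0"
  shows "2 * card (even_part d n) = n ^ d" "2 * card (odd_part d n) = n ^ d"
proof -
  have "bij_betw (\<lambda>x. shift n x 0 1) (even_part d n) (odd_part d n)"
    using assms shift_shift[of _ d n 0 1] shift_shift[of _ d n 0 "-1"]
    by (intro bij_betw_byWitness[where f' = "\<lambda>x. shift n x 0 (-1)"])
      (auto simp: even_part_def odd_part_def shift_in_torus even_sum_shift)
  then have "card (even_part d n) = card (odd_part d n)"
    by (rule bij_betw_same_card)
  moreover have "card (even_part d n) + card (odd_part d n) = n ^ d"
    using even_odd_part[of d n] finite_parts[of d n] by (metis card_Un_disjoint card_torus)
  ultimately show "2 * card (even_part d n) = n ^ d" "2 * card (odd_part d n) = n ^ d"
    by simp_all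
qed

lemma bipartite_torus:
  assumes "even n" "n \<ge> 3"
  shows "bipartite_graph (even_part d n) (odd_part d n) (torus_edges d n) (nbrs d n)"
proof
  have sub: "even_part d n \<subseteq> torus d n" "odd_part d n \<subseteq> torus d n"
    using even_odd_part by blast+
  have parity: "nbrs d n x \<inter> even_part d n = {}" if "x \<in> even_part d n" for x
    using nbrs_parity(1)[OF assms(1) _ that] assms(2) even_odd_part(2)[of d n] by fastforce
  have parity': "nbrs d n x \<inter> odd_part d n = {}" if "x \<in> odd_part d n" for x
    using nbrs_parity(2)[OF assms(1) _ that] assms(2) even_odd_part(2)[of d n] by fastforce
  have stable: "indep I (torus_edges d n)"
    if "I \<subseteq> torus d n" "\<And>x. x \<in> I \<Longrightarrow> nbrs d n x \<inter> I = {}" for I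
    unfolding indep_def using that torus_edges_iff[OF assms(2)] by blast
  show "indep (even_part d n) (torus_edges d n)" "indep (odd_part d n) (torus_edges d n)"
    using stable[OF sub(1) parity] stable[OF sub(2) parity'] by blast+
  show "{a, b} \<in> torus_edges d n \<longleftrightarrow> a \<in> nbrs d n b"
    if "a \<in> even_part d n" "b \<in> odd_part d n" for a b
    using torus_edges_iff[OF assms(2), of b d a] that sub by (simp add: insert_commute subset_iff)
qed (simp_all add: finite_parts even_odd_part)

text \<open>By symmetry of \<open>nbrs\<close>, the set counted here is \<open>nbrs d n a\<close>
  itself. This is the regularity hypothesis of both counting bounds, seen from the even
  class.\<close>

lemma card_preimage_nbrs:
  assumes "even n" "n \<ge> 3" "a \<in> even_part d n"
  shows "card {b \<in> odd_part d n. a \<in> nbrs d n b} = 2 * d"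
proof -
  have "{b \<in> odd_part d n. a \<in> nbrs d n b} = nbrs d n a"
  proof (intro equalityI subsetI)
    fix b assume "b \<in> {b \<in> odd_part d n. a \<in> nbrs d n b}"
    then show "b \<in> nbrs d n a"
      using nbrs_sym[of b d n a] assms(2) by (simp add: odd_part_def)
  next
    fix b assume b: "b \<in> nbrs d n a"
    then have "b \<in> odd_part d n"
      using nbrs_parity(1)[OF assms(1) _ assms(3)] assms(2) by auto
    moreover have "a \<in> nbrs d n b"
      using nbrs_sym[of a d n b] assms(2,3) b by (simp add: even_part_def)
    ultimately show "b \<in> {b \<in> odd_part d n. a \<in> nbrs d n b}" by blast
  qed
  then show ?thesis
    using assms card_nbrs[of a d n] by (simp add: even_part_def)
qed

lemma num_indep_upper:
  assumes "even n" "n \<ge> 3" "d \<ge> 1"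
  shows "real (num_indep d n) \<le> root (2 * d) (2 ^ (2 * d + 1) - 1) ^ (n ^ d div 2)"
proof -
  interpret bipartite_graph "even_part d n" "odd_part d n" "torus_edges d n" "nbrs d n"
    using assms(1,2) by (rule bipartite_torus)
  have "real (indep_count (even_part d n \<union> odd_part d n) (torus_edges d n))
      \<le> root (2 * d) (2 ^ (2 * d + 1) - 1) ^ card (odd_part d n)"
    using assms nbrs_parity[of n _ d] card_preimage_nbrs
    by (intro indep_count_upper) (auto simp: card_nbrs odd_part_def)
  moreover have "card (odd_part d n) = n ^ d div 2"
    using card_parts[of n d] assms by simp
  ultimately show ?thesis
    using assms by (simp add: num_indep_eq even_odd_part)
qed

lemma num_indep_lower:
  assumes "even n" "n \<ge> 3" "d \<ge> 1"
  shows "(2 * (1 + (1 / 2) ^ (2 * d))) ^ (n ^ d div 2) \<le> real (num_indep d n)"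
proof -
  interpret bipartite_graph "even_part d n" "odd_part d n" "torus_edges d n" "nbrs d n"
    using assms(1,2) by (rule bipartite_torus)
  have "card (odd_part d n) = n ^ d div 2" "card (even_part d n) = n ^ d div 2"
    using card_parts[of n d] assms by simp_all
  then show ?thesis
    using indep_count_lower[of "2 * d"] card_preimage_nbrs[OF assms(1,2)] assms
    by (simp add: num_indep_eq even_odd_part flip: power_mult_distrib)
qed

section \<open>Slices and tilings of the torus\<close>

text \<open>The slices on which the last coordinate is constant cover the torus. There are
  \<open>n\<close> of them, and forgetting that coordinate embeds each one in the torus of dimension
  \<open>d\<close>.\<close>

lemma num_indep_Suc_dim:
  assumes "n \<ge> 3"
  shows "num_indep (Suc d) n \<le> num_indep d n ^ n"
proof -
  define slice where "slice c = {x \<in> torus (Suc d) n. x d = c}" for c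
  have "torus (Suc d) n = (\<Union>c\<in>{0..<int n}. slice c)"
    using torus_range[of _ "Suc d" n d] by (auto simp: slice_def)
  then have "num_indep (Suc d) n \<le> (\<Prod>c\<in>{0..<int n}. indep_count (slice c) (torus_edges (Suc d) n))"
    using assms indep_count_UN[of "{0..<int n}" slice "torus_edges (Suc d) n"]
    by (simp add: num_indep_eq slice_def finite_torus)
  also have "\<dots> \<le> (\<Prod>c\<in>{0..<int n}. num_indep d n)"
  proof (rule prod_mono, rule conjI)
    fix c assume "c \<in> {0..<int n}"
    let ?f = "\<lambda>x. restrict x {..<d}"
    have f: "?f x \<in> torus d n" if "x \<in> slice c" for x
      using that by (auto simp: slice_def torus_def PiE_iff)
    have eq: "u = v" if "u \<in> torus (Suc d) n" "v \<in> torus (Suc d) n" "u d = v d" "?f u = ?f v" for u v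
      using that(1,2)
    proof (rule torus_eqI)
      fix i assume "i < Suc d"
      then show "u i = v i"
        using that(3) fun_cong[OF that(4), of i] by (cases "i = d") auto
    qed
    have "{u, v} \<in> torus_edges (Suc d) n"
      if uv: "u \<in> slice c" "v \<in> slice c" "{?f u, ?f v} \<in> torus_edges d n" for u v
    proof -
      obtain i s where i: "i < d" "s \<in> {1, -1}" "?f v = shift n (?f u) i s"
        using uv f assms by (auto simp: torus_edges_iff mem_nbrs_iff)
      have u: "u \<in> torus (Suc d) n" and v: "v \<in> torus (Suc d) n" and "u d = v d"
        using uv by (auto simp: slice_def)
      have u': "shift n u i s \<in> torus (Suc d) n"
        using u i(1) assms by (intro shift_in_torus) auto
      \<comment> \<open>Within a slice the last coordinates agree, so a step between the projections
        lifts to the same step between \<open>u\<close> and \<open>v\<close>.\<close>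
      have "v = shift n u i s"
      proof (rule eq[OF v u'])
        show "?f v = ?f (shift n u i s)"
          using i by (auto simp: shift_def fun_eq_iff)
        show "v d = shift n u i s d"
          using i(1) \<open>u d = v d\<close> by (simp add: shift_def)
      qed
      then have "v \<in> nbrs (Suc d) n u"
        using i less_SucI unfolding mem_nbrs_iff by blast
      then show ?thesis
        using torus_edges_iff[OF assms u v] by simp
    qed
    moreover have "inj_on ?f (slice c)"
      using eq by (intro inj_onI) (simp add: slice_def)
    moreover have "?f ` slice c \<subseteq> torus d n"
      using f by blast
    ultimately have "indep_count (slice c) (torus_edges (Suc d) n) \<le> indep_count (torus d n) (torus_edges d n)"
      using finite_torus by (intro indep_count_embed[where f = ?f]) blast+
    then show "indep_count (slice c) (torus_edges (Suc d) n) \<le> num_indep d n"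
      using assms by (simp add: num_indep_eq)
  qed simp
  finally show ?thesis by simp
qed

text \<open>Translating the corner of the box to the origin puts the box into the torus of side
  \<open>k + 1\<close>. The extra layer keeps opposite faces of the box apart, so every edge between
  image points is a genuine unit step and comes from an edge of the large torus. The assumption
  \<open>k \<ge> 2\<close> makes \<open>torus_edges_iff\<close> available for side
  \<open>k + 1\<close>.\<close>

lemma indep_count_box:
  assumes "k \<ge> 2" "m \<ge> 3"
  shows "indep_count {x \<in> torus d m. \<forall>i<d. int k * q i \<le> x i \<and> x i < int k * q i + int k}
      (torus_edges d m) \<le> num_indep d (k + 1)"
    (is "indep_count ?box _ \<le> _")
proof -
  let ?f = "\<lambda>x. \<lambda>i\<in>{..<d}. x i - int k * q i"
  have f: "?f x \<in> torus d (k + 1)" if "x \<in> ?box" for x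
    using that by (fastforce simp: torus_def)
  have eq: "u = v" if "u \<in> torus d m" "v \<in> torus d m" "?f u = ?f v" for u v
    using that(1,2)
  proof (rule torus_eqI)
    fix i assume "i < d"
    then show "u i = v i" using fun_cong[OF that(3), of i] by simp
  qed
  have "{u, v} \<in> torus_edges d m"
    if uv: "u \<in> ?box" "v \<in> ?box" "{?f u, ?f v} \<in> torus_edges d (k + 1)" for u v
  proof -
    have "?f v \<in> nbrs d (k + 1) (?f u)"
      using uv(3) f[OF uv(1)] f[OF uv(2)] assms torus_edges_iff[of "k + 1"] by simp
    then obtain i s where i: "i < d" "s \<in> {1, -1}" "?f v = shift (k + 1) (?f u) i s"
      unfolding mem_nbrs_iff by blast
    define a b where "a = u i - int k * q i" and "b = v i - int k * q i"
    have ab: "0 \<le> a" "a < int k" "0 \<le> b" "b < int k"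
      using uv(1,2) i(1) by (auto simp: a_def b_def)
    have b_eq: "b = (a + s) mod int (k + 1)"
      using fun_cong[OF i(3), of i] i(1) by (simp add: shift_def a_def b_def)
    \<comment> \<open>The value \<open>k\<close> is not taken inside the box, so there is no wrap-around modulo \<open>k + 1\<close>.\<close>
    have "a + s \<noteq> -1"
    proof
      assume "a + s = -1"
      with b_eq have "b = int k" by (simp add: zmod_minus1)
      with ab show False by simp
    qed
    moreover have "a + s \<noteq> -1 \<Longrightarrow> a + s \<ge> 0" "a + s \<le> int k"
      using ab i(2) by auto
    ultimately have "b = a + s"
      using b_eq by simp
    then have vi: "v i = u i + s"
      by (simp add: a_def b_def)
    have u: "u \<in> torus d m" and v: "v \<in> torus d m"
      using uv by auto
    have "v = shift m u i s"
    proof (rule torus_eqI[OF v])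
      show "shift m u i s \<in> torus d m"
        using u i(1) assms by (intro shift_in_torus) auto
    next
      fix j assume "j < d"
      show "v j = shift m u i s j"
      proof (cases "j = i")
        case True
        then show ?thesis
          using vi torus_range[of v d m i] uv(2) i(1) by (simp add: shift_def)
      next
        case False
        then show ?thesis
          using fun_cong[OF i(3), of j] \<open>j < d\<close> by (simp add: shift_def)
      qed
    qed
    then have "v \<in> nbrs d m u"
      using i unfolding mem_nbrs_iff by blast
    then show ?thesis
      using torus_edges_iff[OF assms(2) u v] by simp
  qed
  moreover have "inj_on ?f ?box"
    using eq by (intro inj_onI) blast
  moreover have "?f ` ?box \<subseteq> torus d (k + 1)"
    using f by blast
  ultimately have "indep_count ?box (torus_edges d m) \<le> indep_count (torus d (k + 1)) (torus_edges d (k + 1))"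
    using finite_torus by (intro indep_count_embed[where f = ?f]) blast+
  then show ?thesis by (simp add: num_indep_eq)
qed

text \<open>The cube of side \<open>k * (m div k)\<close> is filled by \<open>(m div k) ^ d\<close>
  boxes of side \<open>k\<close>, each bounded by \<open>indep_count_box\<close>. Every vertex
  outside the cube costs at most a factor 2.\<close>

lemma num_indep_tiling:
  assumes "k \<ge> 2" "m \<ge> 3"
  shows "num_indep d m \<le> num_indep d (k + 1) ^ ((m div k) ^ d) * 2 ^ (m ^ d - (k * (m div k)) ^ d)"
proof -
  define box where
    "box q = {x \<in> torus d m. \<forall>i<d. int k * q i \<le> x i \<and> x i < int k * q i + int k}" for q
  define rest where "rest = torus d m - torus d (k * (m div k))"
  have sub: "torus d (k * (m div k)) \<subseteq> torus d m"
  proof -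
    have "int (k * (m div k)) \<le> int m" by (simp only: of_nat_le_iff times_div_less_eq_dividend)
    then show ?thesis unfolding torus_def by (intro PiE_mono) auto
  qed
  have card_rest: "card rest = m ^ d - (k * (m div k)) ^ d"
    unfolding rest_def using sub by (subst card_Diff_subset) (auto simp: finite_torus card_torus)
  have "torus d (k * (m div k)) \<subseteq> (\<Union>q\<in>torus d (m div k). box q)"
  proof
    fix x assume x: "x \<in> torus d (k * (m div k))"
    \<comment> \<open>The index of the box that contains \<open>x\<close>.\<close>
    let ?q = "\<lambda>i\<in>{..<d}. x i div int k"
    have "?q \<in> torus d (m div k)"
      unfolding torus_def
    proof (rule restrict_PiE_iff[THEN iffD2], rule ballI)
      fix i assume "i \<in> {..<d}"
      then have "0 \<le> x i" "x i < int k * int (m div k)"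
        using torus_range[OF x, of i] by auto
      moreover have "int k * (x i div int k) \<le> x i"
        using assms(1) mult_div_mod_eq[of "int k" "x i"] pos_mod_sign[of "int k" "x i"] by linarith
      ultimately have "int k * (x i div int k) < int k * int (m div k)" "0 \<le> x i div int k"
        using assms(1) by (linarith, simp add: pos_imp_zdiv_nonneg_iff)
      then show "x i div int k \<in> {0..<int (m div k)}"
        using assms(1) by (simp add: mult_less_cancel_left del: of_nat_mult)
    qed
    moreover have "x \<in> box ?q"
    proof -
      have "int k * (x i div int k) \<le> x i \<and> x i < int k * (x i div int k) + int k" for i
        using assms(1) mult_div_mod_eq[of "int k" "x i"] pos_mod_bound[of "int k" "x i"]
          pos_mod_sign[of "int k" "x i"] by linarith
      then show ?thesis using x sub by (auto simp: box_def)
    qed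
    ultimately show "x \<in> (\<Union>q\<in>torus d (m div k). box q)" by blast
  qed
  then have cover: "torus d m = (\<Union>q\<in>torus d (m div k). box q) \<union> rest"
    by (auto simp: box_def rest_def)
  have fin: "finite rest" "finite (box q)" for q
    by (auto simp: rest_def box_def finite_torus)
  let ?E = "torus_edges d m"
  have "num_indep d m \<le> indep_count (\<Union>q\<in>torus d (m div k). box q) ?E * indep_count rest ?E"
    using indep_count_Un[of "\<Union>q\<in>torus d (m div k). box q" rest ?E] fin assms
    by (simp add: num_indep_eq finite_torus flip: cover)
  also have "\<dots> \<le> (\<Prod>q\<in>torus d (m div k). indep_count (box q) ?E) * 2 ^ card rest"
    using fin by (intro mult_le_mono indep_count_UN indep_count_le) (auto simp: finite_torus)
  also have "(\<Prod>q\<in>torus d (m div k). indep_count (box q) ?E) \<le> (\<Prod>q\<in>torus d (m div k). num_indep d (k + 1))"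
    using indep_count_box[OF assms] by (intro prod_mono) (simp add: box_def)
  finally show ?thesis
    by (simp add: card_torus card_rest)
qed

section \<open>The limit and its bounds\<close>

definition log_density :: "nat \<Rightarrow> nat \<Rightarrow> real"
  where "log_density d n = ln (num_indep d n) / n ^ d"

lemma log_density_bounds:
  assumes "n > 0"
  shows "0 \<le> log_density d n" "log_density d n \<le> ln 2"
proof -
  have "1 \<le> real (num_indep d n)"
    using num_indep_pos[OF assms, of d] by linarith
  moreover have "real (num_indep d n) \<le> 2 ^ (n ^ d)"
    using num_indep_le[OF assms, of d] by (metis of_nat_le_iff of_nat_numeral of_nat_power)
  ultimately have "0 \<le> ln (num_indep d n)" "ln (num_indep d n) \<le> ln (2 ^ (n ^ d))"
    by (auto intro: ln_ge_zero ln_mono)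
  then show "0 \<le> log_density d n" "log_density d n \<le> ln 2"
    using assms by (simp_all add: log_density_def ln_realpow divide_simps mult.commute)
qed

text \<open>The logarithm of \<open>num_indep_tiling\<close>, divided by the number of vertices. The
  result is an average of the density of a box and of \<open>ln 2\<close>, weighted by the fraction
  of vertices that the boxes cover.\<close>

lemma log_density_tiling:
  assumes "k \<ge> 2" "k \<le> m" "m \<ge> 3"
  shows "log_density d m
    \<le> ln (num_indep d (k + 1)) / k ^ d + (1 - (1 - k / m) ^ d) * ln 2"
proof -
  define a where "a = ln (num_indep d (k + 1))"
  \<comment> \<open>The fraction of vertices covered by the boxes; fewer than \<open>k\<close>
    layers are left over in each direction.\<close>
  define t where "t = (real (k * (m div k)) / m) ^ d"
  have le: "k * (m div k) \<le> m" by simp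
  have "m mod k < k" "k * (m div k) + m mod k = m" using assms by auto
  then have ge: "m - k \<le> k * (m div k)" by linarith
  have a: "a \<ge> 0"
    using num_indep_pos[of "k + 1" d] by (simp add: a_def)
  have "t \<le> 1"
    using le assms unfolding t_def by (intro power_le_one) (auto simp del: of_nat_mult)
  have "real m - real k \<le> real (k * (m div k))"
    using ge assms(2) by (metis of_nat_diff of_nat_le_iff)
  then have "1 - real k / m \<le> real (k * (m div k)) / m"
    using assms divide_right_mono[of "real m - real k" "real (k * (m div k))" "real m"]
    by (simp add: diff_divide_distrib)
  then have t_ge: "(1 - real k / m) ^ d \<le> t"
    unfolding t_def using assms by (intro power_mono) auto
  have "real (num_indep d m)
      \<le> real (num_indep d (k + 1)) ^ ((m div k) ^ d) * 2 ^ (m ^ d - (k * (m div k)) ^ d)"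
    using num_indep_tiling[OF assms(1,3), of d] by (simp flip: of_nat_le_iff[where ?'a = real])
  then have "ln (num_indep d m)
      \<le> ln (real (num_indep d (k + 1)) ^ ((m div k) ^ d) * 2 ^ (m ^ d - (k * (m div k)) ^ d))"
    using num_indep_pos[of m d] assms by (intro ln_mono) auto
  also have "\<dots> = real ((m div k) ^ d) * a + real (m ^ d - (k * (m div k)) ^ d) * ln 2"
    using num_indep_pos[of "k + 1" d] by (simp add: ln_mult ln_realpow a_def)
  also have "real (m ^ d - (k * (m div k)) ^ d) = real m ^ d - real (k * (m div k)) ^ d"
    using le by (simp add: of_nat_diff power_mono)
  also have "real ((m div k) ^ d) * a + (real m ^ d - real (k * (m div k)) ^ d) * ln 2
      = m ^ d * (t * (a / k ^ d) + (1 - t) * ln 2)"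
    using assms by (simp add: t_def power_divide power_mult_distrib field_simps)
  finally have "log_density d m \<le> t * (a / k ^ d) + (1 - t) * ln 2"
    using assms by (simp add: log_density_def divide_simps mult.commute)
  \<comment> \<open>The first summand uses \<open>t \<le> 1\<close> together with
    \<open>a \<ge> 0\<close>, the second the lower bound on \<open>t\<close>.\<close>
  also have "\<dots> \<le> 1 * (a / k ^ d) + (1 - (1 - k / m) ^ d) * ln 2"
    using \<open>t \<le> 1\<close> t_ge a by (intro add_mono mult_right_mono) auto
  finally show ?thesis by (simp add: a_def)
qed

text \<open>A variant of Fekete's lemma. The third assumption puts the upper limit of
  \<open>u\<close> below every \<open>w k\<close>, hence below their infimum, while
  \<open>u (k + 1)\<close> is asymptotically \<open>w k\<close> and so cannot stay below the
  infimum. The offset reflects that a box of side \<open>k\<close> is compared with a torus of side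
  \<open>k + 1\<close>.\<close>

lemma convergent_of_asymptotic_bounds:
  fixes u w :: "nat \<Rightarrow> real"
  assumes "\<And>k. k \<ge> K \<Longrightarrow> 0 \<le> w k"
    and "\<And>k. k \<ge> K \<Longrightarrow> e k \<longlonglongrightarrow> 0"
    and "\<And>k. k \<ge> K \<Longrightarrow> \<forall>\<^sub>F m in sequentially. u m \<le> w k + e k m"
    and "(\<lambda>k. w k - u (k + 1)) \<longlonglongrightarrow> 0"
  shows "convergent u"
proof -
  define L where "L = (INF k\<in>{K..}. w k)"
  have bdd: "bdd_below (w ` {K..})" using assms(1) by (intro bdd_belowI[of _ 0]) auto
  have L_le: "L \<le> w k" if "k \<ge> K" for k
    unfolding L_def using bdd that by (intro cINF_lower) auto
  have "(\<lambda>k. u (k + 1)) \<longlonglongrightarrow> L"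
  proof (rule LIMSEQ_I)
    fix r :: real assume r: "r > 0"
    then have "Inf (w ` {K..}) < L + r / 2" by (simp add: L_def)
    \<comment> \<open>This \<open>k\<close> nearly attains the infimum and stays fixed while the
      error \<open>e k m\<close> vanishes as \<open>m\<close> grows.\<close>
    then obtain k where k: "k \<ge> K" "w k < L + r / 2"
      using cInf_lessD[of "w ` {K..}" "L + r / 2"] by auto
    have "\<forall>\<^sub>F m in sequentially. e k m < r / 2"
      using order_tendstoD(2)[OF assms(2)[OF k(1)], of "r / 2"] r by simp
    with assms(3)[OF k(1)] have "\<forall>\<^sub>F m in sequentially. u m < L + r"
      by eventually_elim (use k in linarith)
    then have "\<forall>\<^sub>F m in sequentially. u (m + 1) < L + r"
      by (subst eventually_sequentially_seg)
    moreover have "\<forall>\<^sub>F m in sequentially. w m - u (m + 1) < r"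
      using order_tendstoD(2)[OF assms(4) r] .
    moreover have "\<forall>\<^sub>F m in sequentially. L \<le> w m"
      using eventually_ge_at_top[of K] by eventually_elim (rule L_le)
    ultimately have "\<forall>\<^sub>F m in sequentially. norm (u (m + 1) - L) < r"
      by eventually_elim auto
    then show "\<exists>no. \<forall>n\<ge>no. norm (u (n + 1) - L) < r"
      by (simp add: eventually_sequentially)
  qed
  then have "u \<longlonglongrightarrow> L" by (rule LIMSEQ_offset)
  then show ?thesis by (rule convergentI)
qed

lemma convergent_log_density: "convergent (log_density d)"
proof (rule convergent_of_asymptotic_bounds)
  \<comment> \<open>The count belongs to side \<open>k + 1\<close>, but the normalisation is the
    volume of the box of side \<open>k\<close>. Compared with the log-density at
    \<open>k + 1\<close> this is a factor \<open>((k + 1) / k) ^ d\<close>, which tends to 1; the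
    densities being bounded by \<open>ln 2\<close>, the difference vanishes.\<close>
  define w where "w k = ln (num_indep d (k + 1)) / k ^ d" for k :: nat
  define e where "e k m = (1 - (1 - real k / real m) ^ d) * ln 2" for k m :: nat
  show "0 \<le> w k" for k
    using num_indep_pos[of "k + 1" d] by (simp add: w_def)
  show "e k \<longlonglongrightarrow> 0" for k
  proof -
    have "(\<lambda>m. (1 - (1 - real k / real m) ^ d) * ln 2) \<longlonglongrightarrow> (1 - (1 - 0) ^ d) * ln 2"
      by (intro tendsto_intros lim_const_over_n)
    then show ?thesis by (simp add: e_def[abs_def])
  qed
  show "\<forall>\<^sub>F m in sequentially. log_density d m \<le> w k + e k m" if "k \<ge> 2" for k
    using eventually_ge_at_top[of "max 3 k"]
    by eventually_elim (use log_density_tiling[OF that, of _ d] in \<open>simp add: w_def e_def\<close>)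
  have q: "(\<lambda>k. (real (k + 1) / real k) ^ d - 1) \<longlonglongrightarrow> 0"
  proof -
    have "(\<lambda>k. (1 + 1 / real k) ^ d - 1) \<longlonglongrightarrow> (1 + 0) ^ d - 1"
      by (intro tendsto_intros lim_const_over_n)
    then have "(\<lambda>k. (1 + 1 / real k) ^ d - 1) \<longlonglongrightarrow> 0" by simp
    moreover have "\<forall>\<^sub>F k in sequentially. (1 + 1 / real k) ^ d - 1 = (real (k + 1) / real k) ^ d - 1"
      using eventually_gt_at_top[of 0] by eventually_elim (simp add: field_simps)
    ultimately show ?thesis by (rule Lim_transform_eventually)
  qed
  show "(\<lambda>k. w k - log_density d (k + 1)) \<longlonglongrightarrow> 0"
  proof (rule tendsto_norm_zero_cancel[OF tendsto_sandwich[OF _ _ tendsto_const]])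
    show "\<forall>\<^sub>F k in sequentially. 0 \<le> norm (w k - log_density d (k + 1))"
      by simp
    show "(\<lambda>k. ln 2 * ((real (k + 1) / real k) ^ d - 1)) \<longlonglongrightarrow> 0"
      using tendsto_mult_left[OF q, of "ln 2"] by simp
    show "\<forall>\<^sub>F k in sequentially. norm (w k - log_density d (k + 1))
        \<le> ln 2 * ((real (k + 1) / real k) ^ d - 1)"
      using eventually_gt_at_top[of 0]
    proof eventually_elim
      case (elim k)
      have "w k - log_density d (k + 1) = log_density d (k + 1) * ((real (k + 1) / real k) ^ d - 1)"
        using elim by (simp add: w_def log_density_def power_divide field_simps)
      moreover have "1 \<le> (real (k + 1) / real k) ^ d"
        using elim by (intro one_le_power) simp
      ultimately show ?case
        using log_density_bounds[of "k + 1" d] by (auto intro: mult_right_mono)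
    qed
  qed
qed

lemma num_indep_powr_eq:
  assumes "n > 0"
  shows "real (num_indep d n) powr (1 / real (n ^ d)) = exp (log_density d n)"
  using num_indep_pos[OF assms, of d] by (simp add: powr_def log_density_def)

text \<open>This gives the \<open>lim\<close> in \<open>kappa_def\<close> its meaning; the later
  arguments reach \<open>kappa\<close> through this convergence.\<close>

lemma kappa_tendsto: "(\<lambda>n. real (num_indep d n) powr (1 / real (n ^ d))) \<longlonglongrightarrow> kappa d"
proof -
  obtain L where "log_density d \<longlonglongrightarrow> L"
    using convergent_log_density convergent_def by blast
  then have "(\<lambda>n. exp (log_density d n)) \<longlonglongrightarrow> exp L"
    by (rule tendsto_exp)
  moreover have "\<forall>\<^sub>F n in sequentially.
      exp (log_density d n) = real (num_indep d n) powr (1 / real (n ^ d))"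
    using eventually_gt_at_top[of 0] by eventually_elim (simp only: num_indep_powr_eq)
  ultimately have "(\<lambda>n. real (num_indep d n) powr (1 / real (n ^ d))) \<longlonglongrightarrow> exp L"
    by (rule Lim_transform_eventually)
  then have "convergent (\<lambda>n. real (num_indep d n) powr (1 / real (n ^ d)))"
    by (rule convergentI)
  then show ?thesis
    unfolding kappa_def by (simp only: convergent_LIMSEQ_iff)
qed

section \<open>Monotonicity and explicit bounds\<close>

text \<open>The sides \<open>2 * k + 4\<close> are even and at least 3, as the bipartite bounds
  require; a subsequence suffices because the limit exists.\<close>

lemma kappa_tendsto_even:
  "(\<lambda>k. real (num_indep d (2 * k + 4)) powr (1 / real ((2 * k + 4) ^ d))) \<longlonglongrightarrow> kappa d"
proof -
  have "strict_mono (\<lambda>k::nat. 2 * k + 4)"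
    by (simp add: strict_mono_def)
  from LIMSEQ_subseq_LIMSEQ[OF kappa_tendsto[of d] this] show ?thesis
    by (simp add: o_def)
qed

lemma kappa_Suc_le: "kappa (Suc d) \<le> kappa d"
proof (rule LIMSEQ_le[OF kappa_tendsto kappa_tendsto], intro exI allI impI)
  fix n :: nat assume n: "n \<ge> 3"
  have "real (num_indep (Suc d) n) \<le> real (num_indep d n) ^ n"
    using num_indep_Suc_dim[OF n, of d] by (metis of_nat_le_iff of_nat_power)
  then have "real (num_indep (Suc d) n) powr (1 / real (n ^ Suc d))
      \<le> (real (num_indep d n) ^ n) powr (1 / real (n ^ Suc d))"
    by (intro powr_mono2) auto
  also have "\<dots> = real (num_indep d n) powr (1 / real (n ^ d))"
    using n num_indep_pos[of n d] by (simp add: powr_powr flip: powr_realpow)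
  finally show "real (num_indep (Suc d) n) powr (1 / real (n ^ Suc d))
      \<le> real (num_indep d n) powr (1 / real (n ^ d))" .
qed

text \<open>Each class of the bipartition holds half of the \<open>N\<close> vertices, so a bound
  per vertex of one class enters \<open>kappa\<close> through its square root.\<close>

lemma power_half_powr:
  fixes x :: real
  assumes "even N" "N > 0" "x > 0"
  shows "(x ^ (N div 2)) powr (1 / real N) = sqrt x"
  using assms by (auto simp: powr_powr powr_half_sqrt elim!: evenE simp flip: powr_realpow)

lemma kappa_upper:
  assumes "d \<ge> 1"
  shows "kappa d \<le> (2 ^ (2 * d + 1) - 1) powr (1 / (4 * real d))"
proof (rule LIMSEQ_le_const2[OF kappa_tendsto_even], intro exI allI impI)
  fix k :: nat
  define n where "n = 2 * k + 4"
  define X :: real where "X = 2 ^ (2 * d + 1) - 1"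
  have n: "even n" "n \<ge> 3" by (auto simp: n_def)
  have "(1::real) < 2 ^ (2 * d + 1)" by (rule one_less_power) auto
  then have "X > 0" by (simp add: X_def)
  then have root: "root (2 * d) X > 0" using assms by simp
  have "real (num_indep d n) powr (1 / real (n ^ d)) \<le> (root (2 * d) X ^ (n ^ d div 2)) powr (1 / real (n ^ d))"
    using num_indep_upper[OF n assms] unfolding X_def by (intro powr_mono2) auto
  also have "\<dots> = sqrt (root (2 * d) X)"
    using n assms root by (intro power_half_powr) auto
  also have "\<dots> = X powr (1 / (4 * real d))"
    using \<open>X > 0\<close> assms root by (simp add: root_powr_inverse powr_powr flip: powr_half_sqrt)
  finally show "real (num_indep d (2 * k + 4)) powr (1 / real ((2 * k + 4) ^ d))
      \<le> (2 ^ (2 * d + 1) - 1) powr (1 / (4 * real d))"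
    by (simp add: n_def X_def)
qed

lemma kappa_lower:
  assumes "d \<ge> 1"
  shows "sqrt (2 * (1 + (1 / 2) ^ (2 * d))) \<le> kappa d"
proof (rule LIMSEQ_le_const[OF kappa_tendsto_even], intro exI allI impI)
  fix k :: nat
  define n where "n = 2 * k + 4"
  have n: "even n" "n \<ge> 3" by (auto simp: n_def)
  let ?X = "2 * (1 + (1 / 2) ^ (2 * d)) :: real"
  have "?X > 0" by (intro mult_pos_pos add_pos_pos) auto
  then have "sqrt ?X = (?X ^ (n ^ d div 2)) powr (1 / real (n ^ d))"
    using n assms by (intro power_half_powr[symmetric]) auto
  also have "\<dots> \<le> real (num_indep d n) powr (1 / real (n ^ d))"
    using num_indep_lower[OF n assms] \<open>?X > 0\<close> by (intro powr_mono2 zero_le_power) auto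
  finally show "sqrt ?X \<le> real (num_indep d (2 * k + 4)) powr (1 / real ((2 * k + 4) ^ d))"
    by (simp add: n_def)
qed

text \<open>By convexity the graph of \<open>exp\<close> on the unit interval lies below its chord.
  The slope of the chord is the factor \<open>exp 1 - 1\<close> in the final estimate.\<close>

lemma exp_le_chord:
  fixes x :: real
  assumes "0 \<le> x" "x \<le> 1"
  shows "exp x \<le> 1 + (exp 1 - 1) * x"
  using convex_onD[OF exp_convex, of x 0 1] assms by (simp add: algebra_simps)

text \<open>Dropping the \<open>- 1\<close> makes the inequality strict and leaves
  \<open>sqrt 2 * exp (ln 2 / (4 * real d))\<close>, to which the chord bound applies.\<close>

lemma upper_bound_less:
  assumes "d \<ge> 1"
  shows "(2 ^ (2 * d + 1) - 1) powr (1 / (4 * real d)) - sqrt 2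
    < sqrt 2 * (exp 1 - 1) * ln 2 / (4 * real d)"
proof -
  have "(1::real) \<le> 2 ^ (2 * d + 1)" by (rule one_le_power) auto
  then have "((2::real) ^ (2 * d + 1) - 1) powr (1 / (4 * real d))
      < (2 ^ (2 * d + 1)) powr (1 / (4 * real d))"
    using assms by (intro powr_less_mono2) auto
  also have "\<dots> = 2 powr (real (2 * d + 1) * (1 / (4 * real d)))"
    by (simp only: powr_powr powr_realpow[symmetric] zero_less_numeral)
  also have "real (2 * d + 1) * (1 / (4 * real d)) = 1 / 2 + 1 / (4 * real d)"
    using assms by (simp add: field_simps)
  also have "2 powr (1 / 2 + 1 / (4 * real d)) = sqrt 2 * exp (ln 2 / (4 * real d))"
    by (simp only: powr_add powr_half_sqrt) (simp add: powr_def)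
  also have "\<dots> \<le> sqrt 2 * (1 + (exp 1 - 1) * (ln 2 / (4 * real d)))"
    using assms ln_2_less_1 by (intro mult_left_mono exp_le_chord) (auto simp: divide_simps)
  finally show ?thesis by (simp add: algebra_simps)
qed

theorem theorem2p10:
  shows "(\<forall>d\<ge>1.
      kappa (d + 1) \<le> kappa d \<and>
      (sqrt 2 < sqrt 2 * (1 + 2 powr (- (2 * real d))) powr (1 / (2 * (2 * (real d)\<^sup>2 + 1))) \<and>
       sqrt 2 * (1 + 2 powr (- (2 * real d))) powr (1 / (2 * (2 * (real d)\<^sup>2 + 1))) \<le> kappa d \<and>
       kappa d \<le> (2 ^ (2 * d + 1) - 1) powr (1 / (4 * real d))) \<and>
      (0 \<le> kappa d - sqrt 2 \<and>
       kappa d - sqrt 2 < sqrt 2 * (exp 1 - 1) * ln 2 / (4 * real d)))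
    \<and> kappa \<longlonglongrightarrow> sqrt 2"
proof -
  define C where "C = sqrt 2 * (exp 1 - 1) * ln 2 / 4"
  have gap: "kappa d - sqrt 2 < sqrt 2 * (exp 1 - 1) * ln 2 / (4 * real d)" if "d \<ge> 1" for d
    using kappa_upper[OF that] upper_bound_less[OF that] by linarith
  have lower1: "sqrt 2 < sqrt 2 * (1 + 2 powr (- (2 * real d))) powr (1 / (2 * (2 * (real d)\<^sup>2 + 1)))"
    for d :: nat
  proof -
    have "0 < 2 * (2 * (real d)\<^sup>2 + 1)"
      by (simp add: add_nonneg_pos)
    then have "1 < (1 + 2 powr (- (2 * real d))) powr (1 / (2 * (2 * (real d)\<^sup>2 + 1)))"
      by (intro gr_one_powr) auto
    then show ?thesis by simp
  qed
  have lower2: "sqrt 2 * (1 + 2 powr (- (2 * real d))) powr (1 / (2 * (2 * (real d)\<^sup>2 + 1))) \<le> kappa d"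
    if "d \<ge> 1" for d
  proof -
    define h :: real where "h = 2 powr (- (2 * real d))"
    have h: "h = (1 / 2) ^ (2 * d)"
      using powr_realpow[of 2 "2 * d"] by (simp add: h_def powr_minus_divide power_one_over)
    \<comment> \<open>The claimed exponent is at most \<open>1 / 2\<close> and the base is at least
      1, so \<open>kappa_lower\<close> is the stronger bound.\<close>
    have "(1 + h) powr (1 / (2 * (2 * (real d)\<^sup>2 + 1))) \<le> (1 + h) powr (1 / 2)"
      by (intro powr_mono) (auto simp: h_def divide_simps add_nonneg_pos)
    then have "sqrt 2 * (1 + h) powr (1 / (2 * (2 * (real d)\<^sup>2 + 1))) \<le> sqrt 2 * (1 + h) powr (1 / 2)"
      by (intro mult_left_mono) auto
    also have "\<dots> = sqrt (2 * (1 + h))"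
      by (simp add: powr_half_sqrt h_def flip: real_sqrt_mult)
    also have "\<dots> \<le> kappa d"
      using kappa_lower[OF that] unfolding h .
    finally show ?thesis unfolding h_def .
  qed
  have nonneg: "0 \<le> kappa d - sqrt 2" if "d \<ge> 1" for d
    using lower1[of d] lower2[OF that] by linarith
  \<comment> \<open>\<open>C\<close> is chosen so that the bound in \<open>gap\<close> reads
    \<open>C / d\<close>; the difference is squeezed between 0 and this.\<close>
  have "(\<lambda>d. kappa d - sqrt 2) \<longlonglongrightarrow> 0"
  proof (rule tendsto_sandwich)
    show "\<forall>\<^sub>F d in sequentially. kappa d - sqrt 2 \<le> C / real d"
      using eventually_ge_at_top[of 1] by eventually_elim (use gap in \<open>force simp: C_def\<close>)
    show "\<forall>\<^sub>F d in sequentially. 0 \<le> kappa d - sqrt 2"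
      using eventually_ge_at_top[of 1] by eventually_elim (rule nonneg)
  qed (auto intro: lim_const_over_n)
  then have "kappa \<longlonglongrightarrow> sqrt 2"
    by (simp add: LIM_zero_iff)
  then show ?thesis
    using kappa_Suc_le kappa_upper lower1 lower2 nonneg gap by (simp only: Suc_eq_plus1[symmetric]) blast
qed

end
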